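(* Let $R$ be a finite commutative ring with identity which is not a field, and let $r$ be the minimum, over all $\gamma^o$-alliances $S'$ of $\Gamma(R)$, of the number of nilpotent elements of index $2$ (i.e. elements $x\neq 0$ with $x^2=0$) contained in the complement $Z(R)^*\setminus S'$. Then $$\gamma^o(\Gamma(\mathbb{Z}_2 \times R))\leq 1+ r + 2 \gamma^o(\Gamma(R)).$$ Moreover, the bound is sharp: equality holds for $R=\mathbb{Z}_8$.
   Context: $Z(R)^*$ denotes the set of nonzero zero-divisors of $R$. The zero-divisor graph $\Gamma(R)$ is the simple graph with vertex set $Z(R)^*$, in which distinct $u,v$ are adjacent if and only if $uv=0$. For a simple graph $\Gamma=(V,E)$, a set $S\subseteq V$ and a vertex $v$, let $\delta_S(v)$ be the number of neighbors of $v$ in $S$ and $\overline{S}=V\setminus S$. A nonempty set $S\subseteq V$ is a global offensive alliance if $\delta_S(v)\geq \delta_{\overline{S}}(v)+1$ for every $v\in\overline{S}$. $\gamma^o(\Gamma)$ is the minimum cardinality of a global offensive alliance of $\Gamma$, and a $\gamma^o$-alliance is a global offensive alliance of cardinality $\gamma^o(\Gamma)$. *)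

theory Defs
  imports
    "HOL-Algebra.Chinese_Remainder"
    "HOL-Number_Theory.Residues"
    "Graph_Theory.Pair_Digraph"
begin

text \<open>
  A simple graph is a \<^typ>\<open>'a pair_pre_digraph\<close> whose arc relation is symmetric and irreflexive
  (locale \<^locale>\<open>pair_graph\<close>): an edge between u and v is the pair of arcs (u, v), (v, u).
\<close>

definition nbr_count :: "'a pair_pre_digraph \<Rightarrow> 'a set \<Rightarrow> 'a \<Rightarrow> nat" where
  "nbr_count G S v = card {u \<in> S. (v, u) \<in> parcs G}"

definition global_offensive_alliance :: "'a pair_pre_digraph \<Rightarrow> 'a set \<Rightarrow> bool" where
  "global_offensive_alliance G S \<longleftrightarrow>
     S \<noteq> {} \<and> S \<subseteq> pverts G \<and>
     (\<forall>v \<in> pverts G - S. nbr_count G S v \<ge> nbr_count G (pverts G - S) v + 1)"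

text \<open>
  The minima below are attained whenever the graph is finite and has a vertex, since the full vertex
  set is then a global offensive alliance; for the graph without vertices they are unspecified.
\<close>

definition goa_number :: "'a pair_pre_digraph \<Rightarrow> nat" where
  "goa_number G = (LEAST k. \<exists>S. global_offensive_alliance G S \<and> card S = k)"

definition min_goa :: "'a pair_pre_digraph \<Rightarrow> 'a set \<Rightarrow> bool" where
  "min_goa G S \<longleftrightarrow> global_offensive_alliance G S \<and> card S = goa_number G"

definition nonzero_zero_divisors :: "('a, 'm) ring_scheme \<Rightarrow> 'a set" where
  "nonzero_zero_divisors R =
     {x \<in> carrier R. x \<noteq> \<zero>\<^bsub>R\<^esub> \<and> (\<exists>y \<in> carrier R. y \<noteq> \<zero>\<^bsub>R\<^esub> \<and> x \<otimes>\<^bsub>R\<^esub> y = \<zero>\<^bsub>R\<^esub>)}"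

definition zero_divisor_graph :: "('a, 'm) ring_scheme \<Rightarrow> 'a pair_pre_digraph" where
  "zero_divisor_graph R =
     \<lparr> pverts = nonzero_zero_divisors R,
       parcs = {(u, v). u \<in> nonzero_zero_divisors R \<and> v \<in> nonzero_zero_divisors R \<and>
                        u \<noteq> v \<and> u \<otimes>\<^bsub>R\<^esub> v = \<zero>\<^bsub>R\<^esub>} \<rparr>"

definition nilpotents_index_2 :: "('a, 'm) ring_scheme \<Rightarrow> 'a set" where
  "nilpotents_index_2 R = {x \<in> carrier R. x \<noteq> \<zero>\<^bsub>R\<^esub> \<and> x [^]\<^bsub>R\<^esub> (2::nat) = \<zero>\<^bsub>R\<^esub>}"

definition min_nilpotents_outside :: "('a, 'm) ring_scheme \<Rightarrow> nat" where
  "min_nilpotents_outside R =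
     (LEAST k. \<exists>S. min_goa (zero_divisor_graph R) S \<and>
                   card ((nonzero_zero_divisors R - S) \<inter> nilpotents_index_2 R) = k)"

lemma zero_divisor_graph_pair_graph:
  assumes "cring R" and "finite (carrier R)"
  shows "pair_graph (zero_divisor_graph R)"
proof -
  interpret cring R by fact
  have fin: "finite (nonzero_zero_divisors R)"
    using assms(2) by (simp add: nonzero_zero_divisors_def)
  have "parcs (zero_divisor_graph R) \<subseteq> nonzero_zero_divisors R \<times> nonzero_zero_divisors R"
    by (auto simp: zero_divisor_graph_def)
  then have fin': "finite (parcs (zero_divisor_graph R))"
    using fin by (meson finite_SigmaI finite_subset)
  have "symmetric (with_proj (zero_divisor_graph R))"
    by (auto simp: symmetric_def zero_divisor_graph_def nonzero_zero_divisors_def m_comm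
        intro!: symI)
  with fin fin' show ?thesis
    by unfold_locales (auto simp: zero_divisor_graph_def)
qed

lemma nonzero_zero_divisors_nonempty:
  assumes "cring R" and "finite (carrier R)" and "\<one>\<^bsub>R\<^esub> \<noteq> \<zero>\<^bsub>R\<^esub>" and "\<not> field R"
  shows "nonzero_zero_divisors R \<noteq> {}"
proof
  assume none: "nonzero_zero_divisors R = {}"
  interpret cring R by fact
  have "x \<in> Units R" if x: "x \<in> carrier R" "x \<noteq> \<zero>\<^bsub>R\<^esub>" for x
  proof -
    have "inj_on (\<lambda>y. x \<otimes>\<^bsub>R\<^esub> y) (carrier R)"
    proof (rule inj_onI)
      fix y z
      assume yz: "y \<in> carrier R" "z \<in> carrier R" "x \<otimes>\<^bsub>R\<^esub> y = x \<otimes>\<^bsub>R\<^esub> z"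
      then have "x \<otimes>\<^bsub>R\<^esub> (y \<ominus>\<^bsub>R\<^esub> z) = \<zero>\<^bsub>R\<^esub>"
        using x by (simp add: minus_eq r_distr r_minus r_neg)
      with none x yz have "y \<ominus>\<^bsub>R\<^esub> z = \<zero>\<^bsub>R\<^esub>"
        unfolding nonzero_zero_divisors_def by blast
      with yz show "y = z" by simp
    qed
    moreover have "(\<lambda>y. x \<otimes>\<^bsub>R\<^esub> y) ` carrier R \<subseteq> carrier R"
      using x by auto
    ultimately have "(\<lambda>y. x \<otimes>\<^bsub>R\<^esub> y) ` carrier R = carrier R"
      using assms(2) by (simp add: endo_inj_surj)
    then obtain y where "y \<in> carrier R" "x \<otimes>\<^bsub>R\<^esub> y = \<one>\<^bsub>R\<^esub>"
      by (metis imageE one_closed)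
    then show ?thesis
      using x m_comm[of x y] unfolding Units_def by auto
  qed
  moreover have "\<zero>\<^bsub>R\<^esub> \<notin> Units R"
    using assms(3) by (auto simp: Units_def)
  ultimately have "Units R = carrier R - {\<zero>\<^bsub>R\<^esub>}"
    using Units_closed by blast
  then show False
    using cring_fieldI assms(4) by blast
qed

lemma min_goa_exists:
  assumes "pverts G \<noteq> {}"
  shows "\<exists>S. min_goa G S"
proof -
  have "global_offensive_alliance G (pverts G)"
    using assms by (simp add: global_offensive_alliance_def)
  then have "\<exists>k S. global_offensive_alliance G S \<and> card S = k"
    by blast
  from LeastI_ex[OF this] show ?thesis
    by (auto simp: min_goa_def goa_number_def)
qed

lemma residue_ring_8:
  shows "cring (residue_ring 8)" and "finite (carrier (residue_ring 8))"
    and "\<one>\<^bsub>residue_ring 8\<^esub> \<noteq> \<zero>\<^bsub>residue_ring 8\<^esub>" and "\<not> field (residue_ring 8)"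
proof -
  interpret residues 8 "residue_ring 8" by unfold_locales auto
  show "cring (residue_ring 8)" by (rule cring)
  show "finite (carrier (residue_ring 8))" by (rule finite)
  show "\<one>\<^bsub>residue_ring 8\<^esub> \<noteq> \<zero>\<^bsub>residue_ring 8\<^esub>" by (simp add: residue_ring_def)
  show "\<not> field (residue_ring 8)"
  proof
    assume "field (residue_ring 8)"
    then interpret F: field "residue_ring 8" .
    show False
      using F.integral[of 2 4] by (simp add: residue_ring_def)
  qed
qed

end

theory Submission
  imports Defs
begin

text \<open>
  Let \<open>S\<close> be a minimum alliance of the zero-divisor graph of \<open>R\<close> and let \<open>N\<close> be the set of index-2
  nilpotents outside \<open>S\<close>. Then \<open>{(1, 0)} \<union> {0} \<times> N \<union> {0, 1} \<times> S\<close> is an alliance for the product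
  \<open>\<int>\<^sub>2 \<times> R\<close>: the vertex \<open>(1, 0)\<close> defends against all \<open>(0, u)\<close> with \<open>u\<close> a unit, the two copies of
  \<open>S\<close> transport the inequality of \<open>S\<close>, and putting \<open>(0, x)\<close> into the alliance for \<open>x \<in> N\<close> accounts
  for the edge between \<open>(0, x)\<close> and \<open>(1, x)\<close>, which is not induced by an edge of the graph of \<open>R\<close>.
  For \<open>\<int>\<^sub>8\<close> the lower bound comes from the leaves of the product graph: the four leaves at \<open>(1, 0)\<close>
  and the two leaves \<open>(1, 2)\<close>, \<open>(1, 6)\<close> at \<open>(0, 4)\<close> leave \<open>{(1, 0), (0, 4)}\<close> as the only candidate
  with fewer than three elements, and it fails at \<open>(1, 4)\<close>.
\<close>

section \<open>General facts on alliances and their minima\<close>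

lemma goa_number_le_card:
  "global_offensive_alliance G S \<Longrightarrow> goa_number G \<le> card S"
  unfolding goa_number_def by (rule Least_le) blast

text \<open>The \<open>+ 1\<close> in the alliance inequality forces every outside vertex to have at
  least one neighbor in \<open>S\<close>. Used for leaves: a leaf left out of \<open>S\<close>
  forces its only neighbor in.\<close>

lemma goa_memI:
  assumes "global_offensive_alliance G S" "v \<in> pverts G" "v \<notin> S"
    and "\<And>u. (v, u) \<in> parcs G \<Longrightarrow> u = w"
  shows "w \<in> S"
proof -
  have "card {u \<in> S. (v, u) \<in> parcs G} > 0"
    using assms(1-3) unfolding global_offensive_alliance_def nbr_count_def by force
  then obtain u where "u \<in> S" "(v, u) \<in> parcs G"
    unfolding card_gt_0_iff by blast
  with assms(4) show ?thesis by blast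
qed

text \<open>The \<open>LEAST\<close> is a genuine minimum because a graph with a vertex has a
  minimum alliance.\<close>

lemma min_nilpotents_outside_attained:
  assumes "nonzero_zero_divisors R \<noteq> {}"
  obtains S where "min_goa (zero_divisor_graph R) S"
    and "card ((nonzero_zero_divisors R - S) \<inter> nilpotents_index_2 R) = min_nilpotents_outside R"
proof -
  have "\<exists>k S. min_goa (zero_divisor_graph R) S \<and>
      card ((nonzero_zero_divisors R - S) \<inter> nilpotents_index_2 R) = k"
    using min_goa_exists[of "zero_divisor_graph R"] assms by (simp add: zero_divisor_graph_def)
  from LeastI_ex[OF this] that show ?thesis
    unfolding min_nilpotents_outside_def by blast
qed

section \<open>Zero-divisors of the product ring\<close>

lemma nonzero_zero_divisorsI:
  assumes "x \<in> carrier R" "x \<noteq> \<zero>\<^bsub>R\<^esub>" "y \<in> carrier R" "y \<noteq> \<zero>\<^bsub>R\<^esub>" "x \<otimes>\<^bsub>R\<^esub> y = \<zero>\<^bsub>R\<^esub>"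
  shows "x \<in> nonzero_zero_divisors R"
  using assms by (auto simp: nonzero_zero_divisors_def)

lemma residue_ring_ops:
  "x \<otimes>\<^bsub>residue_ring m\<^esub> y = x * y mod m" "\<zero>\<^bsub>residue_ring m\<^esub> = 0" "\<one>\<^bsub>residue_ring m\<^esub> = 1"
  by (simp_all add: residue_ring_def)

lemma carrier_residue_ring_2: "carrier (residue_ring 2) = {0, 1}"
  by (auto simp: residue_ring_def)

lemma RDirProd_ops:
  "carrier (RDirProd R S) = carrier R \<times> carrier S"
  "(a, x) \<otimes>\<^bsub>RDirProd R S\<^esub> (b, y) = (a \<otimes>\<^bsub>R\<^esub> b, x \<otimes>\<^bsub>S\<^esub> y)"
  "\<zero>\<^bsub>RDirProd R S\<^esub> = (\<zero>\<^bsub>R\<^esub>, \<zero>\<^bsub>S\<^esub>)"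
  by (simp_all add: RDirProd_def DirProd_def monoid.defs)

text \<open>\<open>(1, \<zero>)\<close> annihilates every \<open>(0, x)\<close>, whether or not
  \<open>x\<close> is a unit. A nonzero annihilator of \<open>(1, x)\<close> must be some
  \<open>(0, y)\<close> with \<open>y\<close> nonzero, so \<open>x\<close> is zero or a
  zero-divisor.\<close>

lemma nonzero_zero_divisors_Z2_prod:
  assumes "cring R" "\<one>\<^bsub>R\<^esub> \<noteq> \<zero>\<^bsub>R\<^esub>"
  shows "nonzero_zero_divisors (RDirProd (residue_ring 2) R) =
    insert (1, \<zero>\<^bsub>R\<^esub>) ({0} \<times> (carrier R - {\<zero>\<^bsub>R\<^esub>}) \<union> {1} \<times> nonzero_zero_divisors R)"
    (is "?L = ?R")
proof -
  interpret cring R by fact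
  have "v \<in> ?L" if "v \<in> ?R" for v
  proof -
    from that consider (one_zero) "v = (1, \<zero>\<^bsub>R\<^esub>)"
      | (zero) x where "v = (0, x)" "x \<in> carrier R" "x \<noteq> \<zero>\<^bsub>R\<^esub>"
      | (one) x y where "v = (1, x)" "x \<in> carrier R" "x \<noteq> \<zero>\<^bsub>R\<^esub>"
          "y \<in> carrier R" "y \<noteq> \<zero>\<^bsub>R\<^esub>" "x \<otimes>\<^bsub>R\<^esub> y = \<zero>\<^bsub>R\<^esub>"
      by (auto simp: nonzero_zero_divisors_def)
    then show ?thesis
    proof cases
      case one_zero
      with assms(2) show ?thesis
        by (intro nonzero_zero_divisorsI[of _ _ "(0, \<one>\<^bsub>R\<^esub>)"])
          (simp_all add: RDirProd_ops carrier_residue_ring_2 residue_ring_ops)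
    next
      case zero
      then show ?thesis
        by (intro nonzero_zero_divisorsI[of _ _ "(1, \<zero>\<^bsub>R\<^esub>)"])
          (simp_all add: RDirProd_ops carrier_residue_ring_2 residue_ring_ops)
    next
      case one
      then show ?thesis
        by (intro nonzero_zero_divisorsI[of _ _ "(0, y)"])
          (simp_all add: RDirProd_ops carrier_residue_ring_2 residue_ring_ops)
    qed
  qed
  moreover have "v \<in> ?R" if "v \<in> ?L" for v
  proof -
    from that obtain a x b y where "v = (a, x)" "a \<in> {0, 1}" "x \<in> carrier R" "(a, x) \<noteq> (0, \<zero>\<^bsub>R\<^esub>)"
      "b \<in> {0, 1}" "y \<in> carrier R" "(b, y) \<noteq> (0, \<zero>\<^bsub>R\<^esub>)" "a * b mod 2 = 0" "x \<otimes>\<^bsub>R\<^esub> y = \<zero>\<^bsub>R\<^esub>"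
      unfolding nonzero_zero_divisors_def
      by (fastforce simp: RDirProd_ops carrier_residue_ring_2 residue_ring_ops)
    then show ?thesis
      using nonzero_zero_divisorsI[of x R y] by auto
  qed
  ultimately show ?thesis by blast
qed

section \<open>The upper bound\<close>

lemma goa_number_Z2_prod_le:
  assumes "cring R" "finite (carrier R)" "\<one>\<^bsub>R\<^esub> \<noteq> \<zero>\<^bsub>R\<^esub>" "\<not> field R"
  shows "goa_number (zero_divisor_graph (RDirProd (residue_ring 2) R))
    \<le> 1 + min_nilpotents_outside R + 2 * goa_number (zero_divisor_graph R)"
proof -
  interpret cring R by fact
  define Z where "Z = nonzero_zero_divisors R"
  define G where "G = zero_divisor_graph R"
  define G' where "G' = zero_divisor_graph (RDirProd (residue_ring 2) R)"
  \<comment> \<open>One \<open>S\<close> realizes both quantities of the bound, since the minimum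
    over nilpotents ranges only over minimum alliances.\<close>
  obtain S where S: "min_goa G S"
    and card_N: "card ((Z - S) \<inter> nilpotents_index_2 R) = min_nilpotents_outside R"
    using min_nilpotents_outside_attained[OF nonzero_zero_divisors_nonempty[OF assms]]
    unfolding G_def Z_def by blast
  define N where "N = (Z - S) \<inter> nilpotents_index_2 R"
  define T where "T = insert (1::int, \<zero>\<^bsub>R\<^esub>) ({0} \<times> N \<union> {0, 1} \<times> S)"
  have Zc: "Z \<subseteq> carrier R - {\<zero>\<^bsub>R\<^esub>}"
    by (auto simp: Z_def nonzero_zero_divisors_def)
  have vG: "pverts G = Z"
    by (simp add: G_def Z_def zero_divisor_graph_def)
  have vG': "pverts G' = insert (1, \<zero>\<^bsub>R\<^esub>) ({0} \<times> (carrier R - {\<zero>\<^bsub>R\<^esub>}) \<union> {1} \<times> Z)"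
    using nonzero_zero_divisors_Z2_prod[OF assms(1,3)]
    by (simp add: G'_def Z_def zero_divisor_graph_def)
  have aG: "(x, y) \<in> parcs G \<longleftrightarrow> x \<in> Z \<and> y \<in> Z \<and> x \<noteq> y \<and> x \<otimes>\<^bsub>R\<^esub> y = \<zero>\<^bsub>R\<^esub>" for x y
    by (simp add: G_def Z_def zero_divisor_graph_def)
  have aG': "((a, x), (b, y)) \<in> parcs G' \<longleftrightarrow> (a, x) \<in> pverts G' \<and> (b, y) \<in> pverts G' \<and>
      (a, x) \<noteq> (b, y) \<and> (a * b) mod 2 = 0 \<and> x \<otimes>\<^bsub>R\<^esub> y = \<zero>\<^bsub>R\<^esub>" for a b x y
    by (auto simp: G'_def zero_divisor_graph_def RDirProd_ops residue_ring_ops)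
  have zero_div: "y \<in> Z" if "x \<in> Z" "x \<otimes>\<^bsub>R\<^esub> y = \<zero>\<^bsub>R\<^esub>" "y \<in> carrier R" "y \<noteq> \<zero>\<^bsub>R\<^esub>" for x y
    using that Zc m_comm[of x y] unfolding Z_def nonzero_zero_divisors_def by auto
  have SZ: "S \<subseteq> Z" and S_alliance: "\<And>x. x \<in> Z - S \<Longrightarrow>
      card {u \<in> Z - S. (x, u) \<in> parcs G} + 1 \<le> card {u \<in> S. (x, u) \<in> parcs G}"
    using S by (auto simp: min_goa_def global_offensive_alliance_def nbr_count_def vG)
  have finZ: "finite Z" and finS: "finite S" and finN: "finite N"
    using assms(2) Zc SZ by (auto simp: N_def intro: finite_subset)
  have finT: "finite T"
    using finS finN by (simp add: T_def)
  have T_sub: "T \<subseteq> pverts G'"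
    using Zc SZ by (auto simp: T_def vG' N_def)
  have "nbr_count G' (pverts G' - T) v + 1 \<le> nbr_count G' T v" if v: "v \<in> pverts G' - T" for v
  proof -
    from v consider (nonzero_div) x where "v = (0, x)" "x \<in> carrier R - {\<zero>\<^bsub>R\<^esub>}" "x \<notin> Z"
      | (zero) x where "v = (0, x)" "x \<in> Z - S" "x \<notin> nilpotents_index_2 R"
      | (one) x where "v = (1, x)" "x \<in> Z - S"
      by (auto simp: vG' T_def N_def)
    then show ?thesis
    proof cases
      case nonzero_div
      \<comment> \<open>As \<open>x\<close> is no zero-divisor, a neighbor has second coordinate
        zero, and \<open>(1, \<zero>)\<close> is the only such vertex.\<close>
      have only: "(v, u) \<in> parcs G' \<longleftrightarrow> u = (1, \<zero>\<^bsub>R\<^esub>)" for u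
      proof (cases u)
        case (Pair b y)
        show ?thesis
          using nonzero_div Zc unfolding Pair nonzero_div(1) aG'
          by (auto simp: vG' Z_def nonzero_zero_divisors_def)
      qed
      have "{u \<in> T. (v, u) \<in> parcs G'} = {(1, \<zero>\<^bsub>R\<^esub>)}"
        "{u \<in> pverts G' - T. (v, u) \<in> parcs G'} = {}"
        unfolding only by (auto simp: T_def)
      then show ?thesis unfolding nbr_count_def by (simp only: card.empty) simp
    next
      case zero
      \<comment> \<open>So \<open>(1, x)\<close> is not a neighbor of \<open>(0, x)\<close>: every
        neighbor outside \<open>T\<close> is one of two copies of a neighbor of \<open>x\<close>
        outside \<open>S\<close>.\<close>
      have sq: "x \<otimes>\<^bsub>R\<^esub> x \<noteq> \<zero>\<^bsub>R\<^esub>"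
        using zero Zc by (auto simp: nilpotents_index_2_def numeral_2_eq_2)
      have "{u \<in> pverts G' - T. (v, u) \<in> parcs G'} \<subseteq> {0, 1} \<times> {u \<in> Z - S. (x, u) \<in> parcs G}"
        using zero Zc sq by (auto simp: aG' aG vG' T_def intro: zero_div)
      from card_mono[OF _ this] have outside:
        "nbr_count G' (pverts G' - T) v \<le> 2 * card {u \<in> Z - S. (x, u) \<in> parcs G}"
        using finZ by (simp add: nbr_count_def card_cartesian_product)
      have "card (insert (1::int, \<zero>\<^bsub>R\<^esub>) ({0, 1} \<times> {u \<in> S. (x, u) \<in> parcs G}))
          \<le> nbr_count G' T v"
        unfolding nbr_count_def using finT zero Zc SZ
        by (intro card_mono) (auto simp: aG' aG vG' T_def)
      moreover have "card (insert (1::int, \<zero>\<^bsub>R\<^esub>) ({0, 1} \<times> {u \<in> S. (x, u) \<in> parcs G}))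
          = 1 + 2 * card {u \<in> S. (x, u) \<in> parcs G}"
        using finS Zc SZ by (subst card_insert_disjoint) (auto simp: card_cartesian_product)
      ultimately have "1 + 2 * card {u \<in> S. (x, u) \<in> parcs G} \<le> nbr_count G' T v"
        by simp
      then show ?thesis
        using outside S_alliance[OF zero(2)] by linarith
    next
      case one
      \<comment> \<open>The only possible neighbor of \<open>(1, x)\<close> not induced by an edge
        of \<open>G\<close> is \<open>(0, x)\<close>; when it is adjacent, \<open>x\<close> lies in
        \<open>N\<close>, so it counts inside \<open>T\<close>.\<close>
      have sq: "(0, x) \<in> T" if "x \<otimes>\<^bsub>R\<^esub> x = \<zero>\<^bsub>R\<^esub>"
        using that one Zc by (auto simp: T_def N_def nilpotents_index_2_def numeral_2_eq_2)
      \<comment> \<open>Two first coordinates \<open>1\<close> have nonzero product, so only the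
        copy over \<open>0\<close> is adjacent to \<open>(1, x)\<close>, and no factor 2
        arises.\<close>
      have "{u \<in> pverts G' - T. (v, u) \<in> parcs G'} \<subseteq> {0} \<times> {u \<in> Z - S. (x, u) \<in> parcs G}"
      proof
        fix u assume u: "u \<in> {u \<in> pverts G' - T. (v, u) \<in> parcs G'}"
        obtain b y where u_eq: "u = (b, y)" by fastforce
        have "b = 0" "y \<in> carrier R" "y \<noteq> \<zero>\<^bsub>R\<^esub>" "x \<otimes>\<^bsub>R\<^esub> y = \<zero>\<^bsub>R\<^esub>" "y \<notin> S" "y \<noteq> x"
          using u one sq unfolding u_eq by (auto simp: aG' vG' T_def)
        then show "u \<in> {0} \<times> {u \<in> Z - S. (x, u) \<in> parcs G}"
          using one zero_div[of x y] by (auto simp: u_eq aG)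
      qed
      from card_mono[OF _ this] have
        "nbr_count G' (pverts G' - T) v \<le> card {u \<in> Z - S. (x, u) \<in> parcs G}"
        using finZ by (simp add: nbr_count_def card_cartesian_product)
      moreover have "{0} \<times> {u \<in> S. (x, u) \<in> parcs G} \<subseteq> {u \<in> T. (v, u) \<in> parcs G'}"
        using one Zc SZ by (auto simp: aG' aG vG' T_def)
      from card_mono[OF _ this] have
        "card {u \<in> S. (x, u) \<in> parcs G} \<le> nbr_count G' T v"
        using finT by (simp add: nbr_count_def card_cartesian_product)
      ultimately show ?thesis
        using S_alliance[OF one(2)] by linarith
    qed
  qed
  then have "global_offensive_alliance G' T"
    using T_sub by (auto simp: global_offensive_alliance_def T_def)
  then have "goa_number G' \<le> card T"
    by (rule goa_number_le_card)
  also have "card T \<le> Suc (card ({0::int} \<times> N \<union> {0, 1} \<times> S))"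
    unfolding T_def by (rule card_insert_le_m1) simp_all
  also have "\<dots> \<le> 1 + (card N + 2 * card S)"
    using card_Un_le[of "{0::int} \<times> N" "{0, 1} \<times> S"] by (simp add: card_cartesian_product)
  finally have "goa_number G' \<le> 1 + (card N + 2 * card S)" .
  moreover have "card N = min_nilpotents_outside R" "card S = goa_number G"
    using card_N S by (simp_all only: N_def min_goa_def)
  ultimately show ?thesis
    unfolding G_def G'_def by linarith
qed

section \<open>Sharpness for the integers modulo 8\<close>

lemma carrier_residue_ring_8: "carrier (residue_ring 8) = {0, 1, 2, 3, 4, 5, 6, 7}"
  by (auto simp: residue_ring_def)

lemma nonzero_zero_divisors_residue_ring_8:
  "nonzero_zero_divisors (residue_ring 8) = {2, 4, 6}"
  unfolding nonzero_zero_divisors_def carrier_residue_ring_8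
  by (auto simp: residue_ring_ops)

text \<open>The graph is the path 2 - 4 - 6, whose center alone dominates both ends; no alliance is
  smaller because alliances are nonempty.\<close>

lemma min_goa_residue_ring_8: "min_goa (zero_divisor_graph (residue_ring 8)) {4}"
proof -
  let ?G = "zero_divisor_graph (residue_ring 8)"
  have arcs: "parcs ?G = {(2, 4), (4, 2), (4, 6), (6, 4)}"
    by (auto simp: zero_divisor_graph_def nonzero_zero_divisors_residue_ring_8 residue_ring_ops)
  have verts: "pverts ?G = {2, 4, 6}"
    by (simp add: zero_divisor_graph_def nonzero_zero_divisors_residue_ring_8)
  have "nbr_count ?G (pverts ?G - {4}) v + 1 \<le> nbr_count ?G {4} v" if "v \<in> pverts ?G - {4}" for v
  proof -
    have v: "v = 2 \<or> v = 6" using that verts by auto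
    then have "{u \<in> {4}. (v, u) \<in> parcs ?G} = {4}"
      "{u \<in> pverts ?G - {4}. (v, u) \<in> parcs ?G} = {}"
      unfolding arcs verts by auto
    then show ?thesis unfolding nbr_count_def by (simp only: card.empty) simp
  qed
  then have goa: "global_offensive_alliance ?G {4}"
    unfolding global_offensive_alliance_def verts by blast
  have "card S \<ge> 1" if "global_offensive_alliance ?G S" for S
    using that finite_subset[of S "{2, 4, 6}"]
    by (auto simp: global_offensive_alliance_def verts Suc_le_eq card_gt_0_iff)
  then have "goa_number ?G = 1"
    unfolding goa_number_def using goa by (intro Least_equality) auto
  with goa show ?thesis
    by (simp add: min_goa_def)
qed

text \<open>Both 2 and 6 square to 4 modulo 8, so the alliance \<open>{4}\<close> leaves no
  nilpotent of index 2 outside.\<close>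

lemma min_nilpotents_outside_residue_ring_8: "min_nilpotents_outside (residue_ring 8) = 0"
proof -
  interpret cring "residue_ring 8" by (rule residue_ring_8)
  have "(nonzero_zero_divisors (residue_ring 8) - {4}) \<inter> nilpotents_index_2 (residue_ring 8) = {}"
    by (auto simp: nonzero_zero_divisors_residue_ring_8 nilpotents_index_2_def numeral_2_eq_2
        carrier_residue_ring_8 residue_ring_ops)
  then show ?thesis
    unfolding min_nilpotents_outside_def
    using min_goa_residue_ring_8 by (intro Least_eq_0) (auto intro!: exI[of _ "{4}"])
qed

lemma goa_number_Z2_Z8_ge:
  "goa_number (zero_divisor_graph (RDirProd (residue_ring 2) (residue_ring 8))) \<ge> 3"
proof -
  let ?G = "zero_divisor_graph (RDirProd (residue_ring 2) (residue_ring 8))"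
  have verts: "pverts ?G = {(1, 0), (0, 1), (0, 2), (0, 3), (0, 4), (0, 5), (0, 6), (0, 7),
      (1, 2), (1, 4), (1, 6)}"
    using nonzero_zero_divisors_Z2_prod[OF residue_ring_8(1,3)]
    unfolding nonzero_zero_divisors_residue_ring_8 carrier_residue_ring_8
    by (auto simp: zero_divisor_graph_def residue_ring_ops)
  have arcs: "((a, x), (b, y)) \<in> parcs ?G \<longleftrightarrow> (a, x) \<in> pverts ?G \<and> (b, y) \<in> pverts ?G \<and>
      (a, x) \<noteq> (b, y) \<and> (a * b) mod 2 = 0 \<and> (x * y) mod 8 = 0" for a b x y
    by (auto simp: zero_divisor_graph_def RDirProd_ops residue_ring_ops)
  have "card S \<ge> 3" if S: "global_offensive_alliance ?G S" for S
  proof (rule ccontr)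
    assume small: "\<not> card S \<ge> 3"
    have finS: "finite S"
      using S finite_subset[of S "pverts ?G"]
      by (auto simp: global_offensive_alliance_def verts)
    have le2: "card A \<le> 2" if "A \<subseteq> S" for A
      using card_mono[OF finS that] small by simp
    have a: "(1, 0) \<in> S"
    proof (rule ccontr)
      assume no: "(1, 0) \<notin> S"
      \<comment> \<open>Three of the four leaves at \<open>(1, 0)\<close> already exceed the size
        limit of two.\<close>
      have "(0, u) \<in> S" if "u \<in> {1, 3, 5}" for u
      proof (rule ccontr)
        assume "(0, u) \<notin> S"
        moreover have "(0, u) \<in> pverts ?G"
          using that by (auto simp: verts)
        moreover have "v = (1, 0)" if "((0, u), v) \<in> parcs ?G" for v
          using that \<open>u \<in> _\<close> by (cases v) (auto simp: arcs verts)
        ultimately show False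
          using goa_memI[OF S] no by blast
      qed
      then have "{(0, 1), (0, 3), (0, 5)} \<subseteq> S" by simp
      from le2[OF this] show False by simp
    qed
    have b: "(0, 4) \<in> S"
    proof (rule ccontr)
      assume no: "(0, 4) \<notin> S"
      \<comment> \<open>Here \<open>(1, 0)\<close> supplies the third element next to the two
        leaves.\<close>
      have "(1, u) \<in> S" if "u \<in> {2, 6}" for u
      proof (rule ccontr)
        assume "(1, u) \<notin> S"
        moreover have "(1, u) \<in> pverts ?G"
          using that by (auto simp: verts)
        moreover have "v = (0, 4)" if "((1, u), v) \<in> parcs ?G" for v
          using that \<open>u \<in> _\<close> by (cases v) (auto simp: arcs verts)
        ultimately show False
          using goa_memI[OF S] no by blast
      qed
      with a have "{(1, 0), (1, 2), (1, 6)} \<subseteq> S" by simp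
      from le2[OF this] show False by simp
    qed
    have S_eq: "S = {(1, 0), (0, 4)}"
      using a b small finS by (intro card_seteq[symmetric]) auto
    \<comment> \<open>The neighbors of \<open>(1, 4)\<close> are \<open>(0, 2)\<close>,
      \<open>(0, 4)\<close> and \<open>(0, 6)\<close>: one inside, two outside.\<close>
    have inside: "{u \<in> S. ((1, 4), u) \<in> parcs ?G} = {(0, 4)}"
      by (auto simp: S_eq arcs verts)
    have outside: "{u \<in> pverts ?G - S. ((1, 4), u) \<in> parcs ?G} = {(0, 2), (0, 6)}"
      by (auto simp: S_eq arcs) (auto simp: verts)
    have "(1, 4) \<in> pverts ?G - S"
      by (simp add: verts S_eq)
    then have "nbr_count ?G (pverts ?G - S) (1, 4) + 1 \<le> nbr_count ?G S (1, 4)"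
      using S unfolding global_offensive_alliance_def by blast
    then show False
      unfolding nbr_count_def inside outside by simp
  qed
  moreover obtain S where "min_goa ?G S"
    using min_goa_exists[of ?G] verts by auto
  ultimately show ?thesis
    unfolding min_goa_def by metis
qed

theorem theorem2p8:
  shows "(\<forall>R :: ('a, 'm) ring_scheme.
            cring R \<and> finite (carrier R) \<and> \<one>\<^bsub>R\<^esub> \<noteq> \<zero>\<^bsub>R\<^esub> \<and> \<not> field R \<longrightarrow>
            goa_number (zero_divisor_graph (RDirProd (residue_ring 2) R))
              \<le> 1 + min_nilpotents_outside R + 2 * goa_number (zero_divisor_graph R)) \<and>
         goa_number (zero_divisor_graph (RDirProd (residue_ring 2) (residue_ring 8)))
           = 1 + min_nilpotents_outside (residue_ring 8)
             + 2 * goa_number (zero_divisor_graph (residue_ring 8))"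
proof (intro conjI allI impI)
  show "goa_number (zero_divisor_graph (RDirProd (residue_ring 2) R))
      \<le> 1 + min_nilpotents_outside R + 2 * goa_number (zero_divisor_graph R)"
    if "cring R \<and> finite (carrier R) \<and> \<one>\<^bsub>R\<^esub> \<noteq> \<zero>\<^bsub>R\<^esub> \<and> \<not> field R" for R :: "('a, 'm) ring_scheme"
    using that goa_number_Z2_prod_le by blast
  show "goa_number (zero_divisor_graph (RDirProd (residue_ring 2) (residue_ring 8)))
      = 1 + min_nilpotents_outside (residue_ring 8)
        + 2 * goa_number (zero_divisor_graph (residue_ring 8))"
    \<comment> \<open>The general bound evaluates to 1 + 0 + 2 * 1 = 3, which meets the lower
      bound.\<close>
    using goa_number_Z2_prod_le[OF residue_ring_8] goa_number_Z2_Z8_ge min_goa_residue_ring_8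
      min_nilpotents_outside_residue_ring_8
    by (simp add: min_goa_def)
qed

end
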